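(* Suppose that for all $j\in\mathcal S^m\setminus\mathcal O^{\mathcal S^m}$ and all $D\in\mathcal M_{\mathcal O^{\mathcal S^m}}^{(\mathcal S^m\setminus\mathcal O^{\mathcal S^m})\cup\mathcal S^1,\,j}$ we have $\sum_{l\in D}|N_l|=|N_j|$. Then there exists a viable ranking of the jobs in $\mathcal S^m$.
   Context: **Network.** $\mathbb N_n=\{1,\dots,n\}$. $K$ is an $I\times J$ matrix with entries in $\{0,1\}$ and nonzero, pairwise distinct columns $K_1,\dots,K_J$; $N_j=\{i\in\mathbb N_I:K_{ij}=1\}$; $\mathcal S^1=\{j\in\mathbb N_J:|N_j|=1\}$. Local traffic assumption: $\bigcup_{j\in\mathcal S^1}N_j=\mathbb N_I$. $\mu_j\in(0,\infty)$ for $j\in\mathbb N_J$ and $h\in(0,\infty)^J$ are given. **Workload cost and job classes.** $M=\mathrm{diag}(1/\mu_j)$, $G=KM$ with columns $g_j$. For $w\in\mathbb R_+^I$: $\mathcal Q(w)=\{q\in\mathbb R_+^J:Gq=w\}$, $\mathcal C(w)=\inf_{q\in\mathcal Q(w)}h\cdot q$. $\mathcal S^p=\{j:\mathcal C(g_j)<h_j\}$ (primary jobs), $\mathcal S^s=\mathbb N_J\setminus\mathcal S^p$ (secondary jobs; contains $\mathcal S^1$), $\mathcal S^m=\mathcal S^s\setminus\mathcal S^1$, $m=|\mathcal S^m|$. **Viable ranking.** For $E,F\subset\mathbb N_J$ and $k\in\mathbb N_J$, $\mathcal M_F^{E,k}$ is the collection of sets $D\subset E\setminus\{k\}$ with $N_k\subset\bigcup_{j\in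 D}N_j$, $N_k\not\subset\bigcup_{j\in D\setminus\{l\}}N_j$ for all $l\in D$, and $N_l\not\subset\bigcup_{j\in D}N_j$ for all $l\in F$. For $E,F\subset\mathcal S^m$, $\mathcal O_F^E$ is the set of $j'\in E$ such that $$\mu_{j'}h_{j'}+\mathcal C\Big(\sum_{j\in D}K_j-K_{j'}\Big)\le\mathcal C\Big(\sum_{j\in D}K_j\Big)\quad\text{for all }D\in\mathcal M_F^{E\cup\mathcal S^1,j'},$$ and $\mathcal O^E=\mathcal O^E_\emptyset$. A viable ranking of jobs in $\mathcal S^m$ is a bijection $\rho:\mathbb N_m\to\mathcal S^m$ such that for all $k\in\mathbb N_m$, $\rho(k)\in\mathcal O_{F_k}^{E_k}$, where $F_k=\{\rho(1),\dots,\rho(k-1)\}$ and $E_k=\mathcal S^m\setminus F_k$ (so $F_1=\emptyset$). *)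

theory Defs
  imports "HOL-Analysis.Analysis"
begin

text \<open>
  Resources are the elements of the finite type \<open>'i\<close> and jobs those of the finite type
  \<open>'j\<close>, so the \<open>I \<times> J\<close> matrix \<open>K\<close> has type \<open>real ^ 'j ^ 'i\<close>, with \<open>K $ i $ j\<close> in row \<open>i\<close>
  and column \<open>j\<close>. Throughout, inclusions of sets are not required to be strict.
\<close>

definition resources :: "real ^ 'j ^ 'i \<Rightarrow> 'j \<Rightarrow> 'i set" where
  "resources K j = {i. K $ i $ j = 1}"

definition single_jobs :: "real ^ 'j ^ 'i \<Rightarrow> 'j set" where
  "single_jobs K = {j. card (resources K j) = 1}"

definition mean_matrix :: "real ^ 'j \<Rightarrow> real ^ 'j ^ 'j" where
  "mean_matrix \<mu> = (\<chi> i j. if i = j then 1 / \<mu> $ j else 0)"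

definition workload_matrix :: "real ^ 'j ^ 'i \<Rightarrow> real ^ 'j \<Rightarrow> real ^ 'j ^ 'i" where
  "workload_matrix K \<mu> = K ** mean_matrix \<mu>"

definition queues :: "real ^ 'j ^ 'i \<Rightarrow> real ^ 'j \<Rightarrow> real ^ 'i \<Rightarrow> (real ^ 'j) set" where
  "queues K \<mu> w = {q. (\<forall>j. 0 \<le> q $ j) \<and> workload_matrix K \<mu> *v q = w}"

text \<open>
  The infimum is that of the reals, hence meaningful only for a nonempty set bounded below.
  For \<open>h\<close> and \<open>\<mu>\<close> positive and \<open>w\<close> nonnegative this is the case under the local
  traffic assumption, and \<open>cost\<close> is only used at nonnegative workloads.
\<close>

definition cost :: "real ^ 'j ^ 'i \<Rightarrow> real ^ 'j \<Rightarrow> real ^ 'j \<Rightarrow> real ^ 'i \<Rightarrow> real" where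
  "cost K \<mu> h w = (INF q\<in>queues K \<mu> w. h \<bullet> q)"

definition primary_jobs :: "real ^ 'j ^ 'i \<Rightarrow> real ^ 'j \<Rightarrow> real ^ 'j \<Rightarrow> 'j set" where
  "primary_jobs K \<mu> h = {j. cost K \<mu> h (column j (workload_matrix K \<mu>)) < h $ j}"

definition secondary_jobs :: "real ^ 'j ^ 'i \<Rightarrow> real ^ 'j \<Rightarrow> real ^ 'j \<Rightarrow> 'j set" where
  "secondary_jobs K \<mu> h = UNIV - primary_jobs K \<mu> h"

definition multi_jobs :: "real ^ 'j ^ 'i \<Rightarrow> real ^ 'j \<Rightarrow> real ^ 'j \<Rightarrow> 'j set" where
  "multi_jobs K \<mu> h = secondary_jobs K \<mu> h - single_jobs K"

text \<open>\<open>minimal_covers K F E k\<close> is the collection written \<open>M\<close> with subscript \<open>F\<close> and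
  superscript \<open>E, k\<close>.\<close>

definition minimal_covers :: "real ^ 'j ^ 'i \<Rightarrow> 'j set \<Rightarrow> 'j set \<Rightarrow> 'j \<Rightarrow> 'j set set" where
  "minimal_covers K F E k = {D. D \<subseteq> E - {k}
     \<and> resources K k \<subseteq> (\<Union>j\<in>D. resources K j)
     \<and> (\<forall>l\<in>D. \<not> resources K k \<subseteq> (\<Union>j\<in>D - {l}. resources K j))
     \<and> (\<forall>l\<in>F. \<not> resources K l \<subseteq> (\<Union>j\<in>D. resources K j))}"

text \<open>\<open>rankable K \<mu> h F E\<close> is the set written \<open>O\<close> with subscript \<open>F\<close> and superscript \<open>E\<close>;
  an omitted subscript stands for the empty set. For \<open>D\<close> in the quantified collection the
  vector \<open>(\<Sum>j\<in>D. column j K) - column j' K\<close> is nonnegative, because \<open>D\<close> covers \<open>j'\<close>.\<close>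

definition rankable ::
  "real ^ 'j ^ 'i \<Rightarrow> real ^ 'j \<Rightarrow> real ^ 'j \<Rightarrow> 'j set \<Rightarrow> 'j set \<Rightarrow> 'j set" where
  "rankable K \<mu> h F E = {j' \<in> E. \<forall>D \<in> minimal_covers K F (E \<union> single_jobs K) j'.
     \<mu> $ j' * h $ j' + cost K \<mu> h ((\<Sum>j\<in>D. column j K) - column j' K)
       \<le> cost K \<mu> h (\<Sum>j\<in>D. column j K)}"

definition viable_ranking ::
  "real ^ 'j ^ 'i \<Rightarrow> real ^ 'j \<Rightarrow> real ^ 'j \<Rightarrow> (nat \<Rightarrow> 'j) \<Rightarrow> bool" where
  "viable_ranking K \<mu> h \<rho> \<longleftrightarrow>
     bij_betw \<rho> {1..card (multi_jobs K \<mu> h)} (multi_jobs K \<mu> h) \<and>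
     (\<forall>k\<in>{1..card (multi_jobs K \<mu> h)}.
        \<rho> k \<in> rankable K \<mu> h (\<rho> ` {1..<k}) (multi_jobs K \<mu> h - \<rho> ` {1..<k}))"

end

theory Submission
  imports Defs
begin

text \<open>
  Rank the jobs of \<open>O = rankable K \<mu> h {} (multi_jobs K \<mu> h)\<close> first and all others after them,
  each group in arbitrary order. The condition defining \<open>rankable\<close> only weakens as jobs move from
  \<open>E\<close> to \<open>F\<close>, so jobs of \<open>O\<close> remain rankable. For any other job \<open>j\<close>, the hypothesis
  forces a minimal cover \<open>D\<close> to partition the resources of \<open>j\<close>; then \<open>\<Sum>l\<in>D. K\<^sub>l = K\<^sub>j\<close> and the
  inequality reduces to \<open>\<mu>\<^sub>j h\<^sub>j + C 0 \<le> C K\<^sub>j\<close>, which holds since \<open>C 0 \<le> 0\<close> and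
  \<open>C K\<^sub>j = \<mu>\<^sub>j C g\<^sub>j \<ge> \<mu>\<^sub>j h\<^sub>j\<close> for a secondary job.
\<close>

lemma column_workload_matrix:
  "column j (workload_matrix K \<mu>) = (1 / \<mu> $ j) *\<^sub>R column j K"
  by (simp add: vec_eq_iff column_def workload_matrix_def mean_matrix_def matrix_matrix_mult_def
      if_distrib cong: if_cong)

lemma scaleR_mem_queues:
  assumes "q \<in> queues K \<mu> w" and "0 \<le> c"
  shows "c *\<^sub>R q \<in> queues K \<mu> (c *\<^sub>R w)"
  using assms by (auto simp: queues_def matrix_vector_mult_scaleR)

text \<open>One unit of job \<open>j\<close> alone realises the workload \<open>g_j\<close>; a
  multiple of this queue shows that \<open>K_j\<close> has a feasible queue.\<close>

lemma axis_mem_queues: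
  "axis j 1 \<in> queues K \<mu> (column j (workload_matrix K \<mu>))"
  by (simp add: queues_def matrix_vector_mult_basis) (simp add: axis_def)

lemma inner_queue_nonneg:
  assumes "\<And>j. 0 \<le> h $ j" and "q \<in> queues K \<mu> w"
  shows "0 \<le> h \<bullet> q"
  using assms by (auto simp: queues_def inner_vec_def intro!: sum_nonneg)

text \<open>Nonnegative holding costs bound the set of values below by 0, so the real infimum is a
  genuine lower bound.\<close>

lemma cost_le:
  assumes "\<And>j. 0 \<le> h $ j" and "q \<in> queues K \<mu> w"
  shows "cost K \<mu> h w \<le> h \<bullet> q"
  unfolding cost_def using assms(2)
  by (intro cINF_lower bdd_belowI2[where m = 0] inner_queue_nonneg[OF assms(1)]) auto

text \<open>The zero queue is feasible for zero workload.\<close>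

lemma cost_zero_le:
  assumes "\<And>j. 0 \<le> h $ j"
  shows "cost K \<mu> h 0 \<le> 0"
  using cost_le[of h 0 K \<mu> 0] assms by (simp add: queues_def)

text \<open>Dividing a queue for \<open>K_j\<close> by \<open>\<mu> $ j\<close> gives a queue for
  \<open>g_j\<close>, whose cost is at least \<open>h $ j\<close> because \<open>j\<close> is not
  primary.\<close>

lemma secondary_cost_ge:
  assumes "\<And>j. 0 < \<mu> $ j" and "\<And>j. 0 \<le> h $ j" and "j \<in> secondary_jobs K \<mu> h"
  shows "\<mu> $ j * h $ j \<le> cost K \<mu> h (column j K)"
  unfolding cost_def
proof (rule cINF_greatest)
  have pos: "0 < \<mu> $ j" by (rule assms(1))
  \<comment> \<open>A bound below an infimum needs a nonempty set; the witness rests on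
    \<open>K_j\<close> being \<open>\<mu> $ j\<close> times \<open>g_j\<close>.\<close>
  have "\<mu> $ j *\<^sub>R axis j 1 \<in> queues K \<mu> (\<mu> $ j *\<^sub>R column j (workload_matrix K \<mu>))"
    using pos by (intro scaleR_mem_queues axis_mem_queues) simp
  then show "queues K \<mu> (column j K) \<noteq> {}"
    using pos by (auto simp: column_workload_matrix)
  fix q assume "q \<in> queues K \<mu> (column j K)"
  then have "(1 / \<mu> $ j) *\<^sub>R q \<in> queues K \<mu> (column j (workload_matrix K \<mu>))"
    using pos unfolding column_workload_matrix by (intro scaleR_mem_queues) simp_all
  then have "cost K \<mu> h (column j (workload_matrix K \<mu>)) \<le> h \<bullet> ((1 / \<mu> $ j) *\<^sub>R q)"
    by (intro cost_le assms(2))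
  moreover have "h $ j \<le> cost K \<mu> h (column j (workload_matrix K \<mu>))"
    using assms(3) by (simp add: secondary_jobs_def primary_jobs_def)
  ultimately have "h $ j \<le> (h \<bullet> q) / \<mu> $ j" by simp
  then show "\<mu> $ j * h $ j \<le> h \<bullet> q"
    using pos by (simp add: pos_le_divide_eq mult.commute)
qed

lemma sum_column_eq_card_resources:
  assumes "\<And>i j. K $ i $ j \<in> {0, 1}"
  shows "(\<Sum>i\<in>UNIV. K $ i $ j) = card (resources K j)"
proof -
  have "K $ i $ j = of_bool (K $ i $ j = 1)" for i
    using assms[of i j] by auto
  then have "(\<Sum>i\<in>UNIV. K $ i $ j) = (\<Sum>i\<in>UNIV. of_bool (K $ i $ j = 1))"
    by (intro sum.cong) auto
  then show ?thesis by (simp add: resources_def)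
qed

text \<open>Covering gives \<le> in every row, and equal cardinalities give equal totals over all
  rows, so no row can be strict.\<close>

lemma sum_columns_eq_column:
  fixes K :: "real ^ 'j ^ 'i"
  assumes K01: "\<And>i j. K $ i $ j \<in> {0, 1}"
    and cover: "resources K j \<subseteq> (\<Union>l\<in>D. resources K l)"
    and card: "(\<Sum>l\<in>D. card (resources K l)) = card (resources K j)"
  shows "(\<Sum>l\<in>D. column l K) = column j K"
proof -
  have le: "K $ i $ j \<le> (\<Sum>l\<in>D. K $ i $ l)" for i
  proof -
    have nonneg: "0 \<le> K $ i $ l" for l using K01[of i l] by auto
    show ?thesis
    proof (cases "K $ i $ j = 1")
      case True
      then obtain l where "l \<in> D" "K $ i $ l = 1"
        using cover by (auto simp: resources_def)
      then show ?thesis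
        using True nonneg member_le_sum[of l D "\<lambda>l. K $ i $ l"] by simp
    next
      case False
      then show ?thesis
        using K01[of i j] nonneg by (simp add: sum_nonneg)
    qed
  qed
  have "(\<Sum>i\<in>UNIV. \<Sum>l\<in>D. K $ i $ l) = (\<Sum>l\<in>D. \<Sum>i\<in>UNIV. K $ i $ l)"
    by (rule sum.swap)
  also have "\<dots> = (\<Sum>i\<in>UNIV. K $ i $ j)"
    using card by (simp add: sum_column_eq_card_resources[OF K01] flip: of_nat_sum)
  finally have "K $ i $ j = (\<Sum>l\<in>D. K $ i $ l)" for i
    by (rule sum_mono_inv[OF sym le UNIV_I finite])
  then show ?thesis
    by (simp add: vec_eq_iff column_def)
qed

text \<open>A smaller \<open>E\<close> leaves fewer candidates and a larger \<open>F\<close> adds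
  constraints, while covering and minimality depend on \<open>D\<close> and \<open>k\<close>
  alone.\<close>

lemma minimal_covers_mono:
  assumes "E' \<subseteq> E" and "F \<subseteq> F'"
  shows "minimal_covers K F' E' k \<subseteq> minimal_covers K F E k"
proof
  fix D assume "D \<in> minimal_covers K F' E' k"
  then show "D \<in> minimal_covers K F E k"
    using assms by (simp add: minimal_covers_def subset_iff)
qed

lemma rankable_mono:
  assumes "E' \<subseteq> E" and "F \<subseteq> F'" and "j \<in> rankable K \<mu> h F E" and "j \<in> E'"
  shows "j \<in> rankable K \<mu> h F' E'"
proof -
  have "minimal_covers K F' (E' \<union> single_jobs K) j \<subseteq> minimal_covers K F (E \<union> single_jobs K) j"
    using assms(1,2) by (intro minimal_covers_mono) auto
  then show ?thesis
    using assms(3,4) by (auto simp: rankable_def)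
qed

lemma rankable_if_covers_exact:
  assumes "\<And>i j. K $ i $ j \<in> {0, 1}" and "\<And>j. 0 < \<mu> $ j" and "\<And>j. 0 \<le> h $ j"
    and "j \<in> secondary_jobs K \<mu> h" and "j \<in> E"
    and exact: "\<And>D. D \<in> minimal_covers K F (E \<union> single_jobs K) j \<Longrightarrow>
      (\<Sum>l\<in>D. card (resources K l)) = card (resources K j)"
  shows "j \<in> rankable K \<mu> h F E"
proof -
  have "\<mu> $ j * h $ j + cost K \<mu> h ((\<Sum>l\<in>D. column l K) - column j K)
      \<le> cost K \<mu> h (\<Sum>l\<in>D. column l K)"
    if D: "D \<in> minimal_covers K F (E \<union> single_jobs K) j" for D
  proof -
    have "(\<Sum>l\<in>D. column l K) = column j K"
    proof (rule sum_columns_eq_column[OF assms(1) _ exact[OF D]])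
      show "resources K j \<subseteq> (\<Union>l\<in>D. resources K l)"
        using D unfolding minimal_covers_def by blast
    qed
    moreover have "\<mu> $ j * h $ j + cost K \<mu> h 0 \<le> cost K \<mu> h (column j K)"
      using cost_zero_le[of h K \<mu>, OF assms(3)] secondary_cost_ge[of \<mu> h j K, OF assms(2-4)]
      by linarith
    ultimately show ?thesis by simp
  qed
  then show ?thesis
    using \<open>j \<in> E\<close> unfolding rankable_def by blast
qed

text \<open>Listing \<open>A\<close> before \<open>S - A\<close> ensures that once an element
  outside \<open>A\<close> appears, all of \<open>A\<close> has been ranked.\<close>

lemma ex_enumeration_prefix:
  assumes "finite S" and "A \<subseteq> S"
  obtains \<rho> :: "nat \<Rightarrow> 'a" where "bij_betw \<rho> {1..card S} S"
    and "\<And>k. k \<in> {1..card S} \<Longrightarrow> \<rho> k \<notin> A \<Longrightarrow> A \<subseteq> \<rho> ` {1..<k}"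
proof -
  obtain xs where xs: "set xs = A" "distinct xs"
    using assms finite_distinct_list finite_subset by metis
  obtain ys where ys: "set ys = S - A" "distinct ys"
    using assms(1) finite_distinct_list[of "S - A"] by auto
  define zs where "zs = xs @ ys"
  have zs: "set zs = S" "distinct zs"
    using xs ys assms(2) by (auto simp: zs_def)
  have len: "length zs = card S"
    using zs distinct_card by metis
  \<comment> \<open>Ranks start at 1 and list positions at 0, hence the shift.\<close>
  define \<rho> where "\<rho> k = zs ! (k - 1)" for k
  have "bij_betw (\<lambda>k. k - 1) {1..card S} {..<length zs}"
    unfolding len by (rule bij_betwI[where g = Suc]) auto
  then have "bij_betw ((!) zs \<circ> (\<lambda>k. k - 1)) {1..card S} S"
    by (rule bij_betw_trans) (simp add: bij_betw_nth zs)
  then have bij: "bij_betw \<rho> {1..card S} S"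
    by (simp add: \<rho>_def[abs_def] o_def)
  have mem_iff: "\<rho> k \<in> A \<longleftrightarrow> k \<le> length xs" if "k \<in> {1..card S}" for k
  proof (cases "k \<le> length xs")
    case True
    then show ?thesis using that xs(1) by (auto simp: \<rho>_def zs_def nth_append)
  next
    case False
    then have "\<rho> k = ys ! (k - 1 - length xs)" "k - 1 - length xs < length ys"
      using that len by (auto simp: \<rho>_def zs_def nth_append)
    then have "\<rho> k \<in> S - A" using ys(1) nth_mem by metis
    then show ?thesis using False by simp
  qed
  show thesis
  proof (rule that[OF bij])
    show "A \<subseteq> \<rho> ` {1..<k}" if k: "k \<in> {1..card S}" "\<rho> k \<notin> A" for k
    proof
      fix a assume "a \<in> A"
      then have "a \<in> \<rho> ` {1..card S}"
        using bij assms(2) by (auto simp: bij_betw_def)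
      then obtain l where l: "l \<in> {1..card S}" "a = \<rho> l" by blast
      \<comment> \<open>Here \<open>l\<close> is at most \<open>length xs\<close>, whereas
        \<open>k\<close> exceeds it.\<close>
      then have "l < k"
        using \<open>a \<in> A\<close> k mem_iff by force
      then show "a \<in> \<rho> ` {1..<k}" using l by auto
    qed
  qed
qed

theorem theorem5p3:
  fixes K :: "real ^ 'j ^ 'i" and \<mu> h :: "real ^ 'j"
  assumes "\<And>i j. K $ i $ j \<in> {0, 1}"
    and "\<And>j. column j K \<noteq> 0"
    and "\<And>j k. j \<noteq> k \<Longrightarrow> column j K \<noteq> column k K"
    and "(\<Union>j\<in>single_jobs K. resources K j) = UNIV"
    and "\<And>j. \<mu> $ j > 0"
    and "\<And>j. h $ j > 0"
    and "\<And>j D. j \<in> multi_jobs K \<mu> h - rankable K \<mu> h {} (multi_jobs K \<mu> h) \<Longrightarrow>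
           D \<in> minimal_covers K (rankable K \<mu> h {} (multi_jobs K \<mu> h))
                 ((multi_jobs K \<mu> h - rankable K \<mu> h {} (multi_jobs K \<mu> h)) \<union> single_jobs K) j \<Longrightarrow>
           (\<Sum>l\<in>D. card (resources K l)) = card (resources K j)"
  shows "\<exists>\<rho>. viable_ranking K \<mu> h \<rho>"
proof -
  define S where "S = multi_jobs K \<mu> h"
  define A where "A = rankable K \<mu> h {} S"
  have "finite S" "A \<subseteq> S"
    by (auto simp: A_def rankable_def)
  then obtain \<rho> where bij: "bij_betw \<rho> {1..card S} S"
    and after: "\<And>k. k \<in> {1..card S} \<Longrightarrow> \<rho> k \<notin> A \<Longrightarrow> A \<subseteq> \<rho> ` {1..<k}"
    by (rule ex_enumeration_prefix) blast
  have "\<rho> k \<in> rankable K \<mu> h (\<rho> ` {1..<k}) (S - \<rho> ` {1..<k})" if k: "k \<in> {1..card S}" for k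
  proof -
    have "\<rho> k \<in> S" using bij k by (auto simp: bij_betw_def)
    \<comment> \<open>Injectivity keeps each job among those still unranked at its own
      stage.\<close>
    moreover have "\<rho> k \<notin> \<rho> ` {1..<k}"
    proof
      assume "\<rho> k \<in> \<rho> ` {1..<k}"
      then obtain l where "l \<in> {1..<k}" "\<rho> k = \<rho> l" by auto
      then show False
        using inj_onD[OF bij_betw_imp_inj_on[OF bij], of k l] k by auto
    qed
    ultimately have mem: "\<rho> k \<in> S - \<rho> ` {1..<k}" by simp
    show ?thesis
    proof (cases "\<rho> k \<in> A")
      case True
      \<comment> \<open>Membership in \<open>A\<close> is rankability with \<open>F\<close> empty
        and \<open>E = S\<close>; later stages only enlarge \<open>F\<close> and shrink
        \<open>E\<close>.\<close>
      show ?thesis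
        by (rule rankable_mono[OF _ _ True[unfolded A_def] mem]) auto
    next
      case False
      show ?thesis
      proof (rule rankable_if_covers_exact[OF assms(1) assms(5) _ _ mem])
        show "0 \<le> h $ j" for j using assms(6)[of j] by simp
        show "\<rho> k \<in> secondary_jobs K \<mu> h"
          using \<open>\<rho> k \<in> S\<close> by (simp add: S_def multi_jobs_def)
        \<comment> \<open>The hypothesis speaks of covers for \<open>A\<close> and
          \<open>S - A\<close> only. Since all of \<open>A\<close> is already ranked, every cover at
          stage \<open>k\<close> is among these.\<close>
        fix D assume "D \<in> minimal_covers K (\<rho> ` {1..<k}) ((S - \<rho> ` {1..<k}) \<union> single_jobs K) (\<rho> k)"
        moreover have "A \<subseteq> \<rho> ` {1..<k}" using after k False by blast
        ultimately have "D \<in> minimal_covers K A ((S - A) \<union> single_jobs K) (\<rho> k)"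
          using minimal_covers_mono[of "(S - \<rho> ` {1..<k}) \<union> single_jobs K"
              "(S - A) \<union> single_jobs K" A "\<rho> ` {1..<k}" K "\<rho> k"] by blast
        then show "(\<Sum>l\<in>D. card (resources K l)) = card (resources K (\<rho> k))"
          using assms(7)[of "\<rho> k" D] \<open>\<rho> k \<in> S\<close> False by (simp add: A_def S_def)
      qed
    qed
  qed
  then show ?thesis
    using bij unfolding viable_ranking_def S_def by blast
qed

end
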